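(* Let $p\equiv 1\pmod 6$ be a prime. Then for any integer $a$ with $1\leq a\leq p-1$, the integer $$j(p)=\sum_{x=0}^{p-1}\bigl(1+\chi(x^{3}+a^{3})\bigr)\,x$$ is divisible by $p$. In particular, $$s(p)=\sum_{x=0}^{p-1}\chi(x^{3}+a^{3})\,x$$ is divisible by $p$.
   Context: $\chi(u)=\left(\frac{u}{p}\right)$ is the Legendre symbol modulo $p$, with $\chi(u)=0$ if $p\mid u$. Here $x$ runs over the integers $0,1,\dots,p-1$. *)

theory Defs
  imports "HOL-Number_Theory.Number_Theory"
begin

end

theory Submission
  imports Defs
begin

text \<open>
  Since \<open>p \<equiv> 1 (mod 3)\<close>, there is a cube root of unity \<open>w \<noteq> 1\<close> modulo \<open>p\<close>. Multiplication by
  \<open>w\<close> permutes the residues modulo \<open>p\<close> and fixes \<open>x\<^sup>3\<close>, hence also every weight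
  \<open>f x\<close> that depends on \<open>x\<close> only through \<open>x\<^sup>3\<close> modulo \<open>p\<close>. Substituting \<open>w x\<close> for \<open>x\<close>
  in \<open>S = (\<Sum>x. f x * x)\<close> therefore gives \<open>S \<equiv> w S (mod p)\<close>, and \<open>S \<equiv> 0\<close> because
  \<open>w - 1\<close> is invertible. Both sums of the theorem have this form, with weights
  \<open>1 + \<chi>(x\<^sup>3 + a\<^sup>3)\<close> and \<open>\<chi>(x\<^sup>3 + a\<^sup>3)\<close>.
\<close>

lemma bij_betw_mult_mod_int:
  fixes m w :: int
  assumes "m > 0" and "coprime w m"
  shows "bij_betw (\<lambda>x. w * x mod m) {0..m - 1} {0..m - 1}"
proof -
  have "inj_on (\<lambda>x. w * x mod m) {0..m - 1}"
  proof (rule inj_onI)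
    fix x y
    assume xy: "x \<in> {0..m - 1}" "y \<in> {0..m - 1}" and eq: "w * x mod m = w * y mod m"
    from eq have "[x = y] (mod m)"
      using cong_mult_lcancel[OF assms(2), of x y] by (simp add: cong_def)
    with xy show "x = y"
      by (simp add: cong_def)
  qed
  moreover have "(\<lambda>x. w * x mod m) ` {0..m - 1} \<subseteq> {0..m - 1}"
    using assms(1) by auto
  ultimately show ?thesis
    by (simp add: bij_betw_def endo_inj_surj)
qed

text \<open>
  The substitution \<open>x \<mapsto> w x\<close> multiplies the weighted sum by \<open>w\<close> modulo \<open>m\<close> while merely
  permuting its terms, so \<open>w - 1\<close> annihilates it modulo \<open>m\<close>.
\<close>

lemma dvd_sum_times_if_scaling_invariant:
  fixes m w :: int and f :: "int \<Rightarrow> int"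
  assumes m: "m > 0" and w: "coprime w m" "coprime (w - 1) m"
    and inv: "\<And>x. f (w * x mod m) = f x"
  shows "m dvd (\<Sum>x = 0..m - 1. f x * x)"
proof -
  let ?S = "\<Sum>x = 0..m - 1. f x * x"
  have "?S = (\<Sum>x = 0..m - 1. f (w * x mod m) * (w * x mod m))"
    by (rule sum.reindex_bij_betw[OF bij_betw_mult_mod_int[OF m w(1)], symmetric])
  also have "\<dots> = (\<Sum>x = 0..m - 1. f x * (w * x mod m))"
    by (simp add: inv)
  also have "[\<dots> = (\<Sum>x = 0..m - 1. f x * (w * x))] (mod m)"
    by (intro cong_sum cong_mult cong_refl) (simp add: cong_def)
  also have "(\<Sum>x = 0..m - 1. f x * (w * x)) = w * ?S"
    by (simp add: sum_distrib_left mult_ac)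
  finally have "[w * ?S = ?S] (mod m)"
    by (rule cong_sym)
  then have "m dvd (w - 1) * ?S"
    by (simp add: cong_iff_dvd_diff algebra_simps)
  with w(2) show ?thesis
    by (simp add: coprime_commute coprime_dvd_mult_right_iff)
qed

text \<open>
  The unit group modulo \<open>p\<close> has \<open>totient 3 = 2\<close> elements of order \<open>3\<close> as soon as \<open>3\<close>
  divides \<open>p - 1\<close>.
\<close>

lemma nontrivial_cube_root_of_unity_mod_prime:
  fixes p :: int
  assumes p: "prime p" and p3: "[p = 1] (mod 3)"
  obtains w :: int where "[w ^ 3 = 1] (mod p)" and "\<not> [w = 1] (mod p)"
proof -
  define q where "q = nat p"
  have q: "prime q" "p = int q"
    using p prime_gt_0_int[OF p] by (auto simp: q_def)
  have "int q mod 3 = 1"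
    using p3 by (simp add: cong_def q)
  then have dvd: "3 dvd q - 1"
    by presburger
  have "card {x \<in> totatives q. ord q x = 3} = totient 3"
    using prime_card_elements_with_ord_eq_totient[OF prime_gt_1_nat[OF q(1)] q(1)] dvd
    by simp
  then have "{x \<in> totatives q. ord q x = 3} \<noteq> {}"
    by (intro notI) simp
  then obtain x where x: "ord q x = 3"
    by blast
  show thesis
  proof
    have "[x ^ 3 = 1] (mod q)"
      using ord_divides[of x 3 q] by (simp add: x)
    then show "[int x ^ 3 = 1] (mod p)"
      by (metis cong_int_iff of_nat_1 of_nat_power q(2))
    have "\<not> [x ^ 1 = 1] (mod q)"
      using ord_divides[of x 1 q] by (simp add: x)
    then show "\<not> [int x = 1] (mod p)"
      by (metis cong_int_iff of_nat_1 power_one_right q(2))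
  qed
qed

lemma Legendre_cong:
  assumes "[u = v] (mod p)"
  shows "Legendre u p = Legendre v p"
proof -
  have "[y = u] (mod p) \<longleftrightarrow> [y = v] (mod p)" for y
    using assms by (auto simp: cong_def)
  moreover have "[u = 0] (mod p) \<longleftrightarrow> [v = 0] (mod p)"
    using assms by (simp add: cong_def)
  ultimately show ?thesis
    by (simp add: Legendre_def QuadRes_def)
qed

theorem theorem7:
  fixes p a :: int
  assumes "prime p" and "[p = 1] (mod 6)"
    and "1 \<le> a" and "a \<le> p - 1"
  shows "p dvd (\<Sum>x = 0..p - 1. (1 + Legendre (x ^ 3 + a ^ 3) p) * x) \<and>
         p dvd (\<Sum>x = 0..p - 1. Legendre (x ^ 3 + a ^ 3) p * x)"
proof -
  have "[p = 1] (mod 3)"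
    using assms(2) by (rule cong_dvd_modulus) simp
  then obtain w where w3: "[w ^ 3 = 1] (mod p)" and w1: "\<not> [w = 1] (mod p)"
    using nontrivial_cube_root_of_unity_mod_prime[OF assms(1)] by blast
  have p: "p > 0"
    using assms(1) by (rule prime_gt_0_int)
  have "coprime (w ^ 3) p"
    using w3 by (metis cong_imp_coprime cong_sym coprime_1_left)
  then have cop: "coprime w p"
    by simp
  have cop1: "coprime (w - 1) p"
    using w1 prime_imp_coprime[OF assms(1), of "w - 1"]
    by (simp add: cong_iff_dvd_diff coprime_commute)
  have inv: "Legendre ((w * x mod p) ^ 3 + a ^ 3) p = Legendre (x ^ 3 + a ^ 3) p" for x
  proof (rule Legendre_cong)
    have "[(w * x mod p) ^ 3 = (w * x) ^ 3] (mod p)"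
      by (intro cong_pow) (simp add: cong_def)
    also have "(w * x) ^ 3 = w ^ 3 * x ^ 3"
      by (rule power_mult_distrib)
    also have "[\<dots> = 1 * x ^ 3] (mod p)"
      by (intro cong_mult w3 cong_refl)
    finally show "[(w * x mod p) ^ 3 + a ^ 3 = x ^ 3 + a ^ 3] (mod p)"
      by (simp add: cong_add)
  qed
  show ?thesis
    by (intro conjI dvd_sum_times_if_scaling_invariant[OF p cop cop1]) (simp_all only: inv)
qed

end
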